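(* Let $n\ge 2$ and let $\mathcal{S}=\{\rho_1,\dots,\rho_N\}$ be a finite set of mutually orthogonal states of an $n$-partite quantum system. If $\mathcal{S}$ is conclusively discriminable under LOCC, then $\mathcal{S}$ admits conclusive local random authentication (conclusive LRA). The converse is false: there exists a finite set of mutually orthogonal multipartite quantum states that admits conclusive LRA but is not conclusively discriminable under LOCC.
   Context: An $n$-partite system ($n\ge 2$) has Hilbert space $\bigotimes_{k=1}^n\mathbb{C}^{d_k}$, each tensor factor being held by a different spatially separated party $B_k$. A state is a density operator on this space (pure states $|\psi\rangle$ are identified with $|\psi\rangle\langle\psi|$); states $\rho,\sigma$ are orthogonal if $\operatorname{Tr}(\rho\sigma)=0$. LOCC has its standard meaning: a protocol with finitely many rounds of local quantum measurements by individual parties and classical communication among all of them; a POVM is LOCC-implementable if its outcome statistics are produced by such a protocol (including classical post-processing). Conclusive LOCC discrimination: $\mathcal{S}=\{\rho_1,\dots,\rho_N\}$ is conclusively discriminable under LOCC if, for the unknown state drawn uniformly from $\mathcal{S}$, there is an LOCC protocol that never misidentifies the state and identifies it with nonzero probability; i.e. there is an LOCC-implementable POVM $\{M_1,\dots,M_N,M_?\}$ with $\operatorname{Tr}(M_k\rho_j)=0$ for all $k\neq j$ and $\frac1N\sum_{k}\operatorname{Tr}(M_k\rho_k)>0$. Conclusive LRA: for the set $\mathcal{S}$, the question $\mathcal{Q}_k$ is "is the shared (unknown) state $\rho_k$ or not?"; the protocol may depend on $k$. The question $\mathcal{Q}_k$ can be conclusively answered with nonzero probability if there is an LOCC-implementable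 POVM $\{M_{\rm yes},M_{\rm no},M_?\}$ (depending on $k$) which never gives a wrong answer, i.e. $\operatorname{Tr}(M_{\rm yes}\rho_j)=0$ for all $j\ne k$ and $\operatorname{Tr}(M_{\rm no}\rho_k)=0$, and which gives a conclusive answer ("yes" or "no") with nonzero probability, i.e. $\frac1N\sum_{j}\operatorname{Tr}[(M_{\rm yes}+M_{\rm no})\rho_j]>0$. The set $\mathcal{S}$ admits conclusive LRA if every question $\mathcal{Q}_1,\dots,\mathcal{Q}_N$ can be conclusively answered with nonzero probability. *)

theory Defs
  imports "Jordan_Normal_Form.Schur_Decomposition"
begin

text \<open>A list \<open>ds\<close> of local dimensions stands for the system whose party \<open>k\<close> (counted
  from \<open>0\<close>) holds \<open>\<complex>^(ds ! k)\<close>. The joint space has dimension \<open>prod_list ds\<close>; its standard product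
  basis is ordered lexicographically, i.e. as prescribed by the Kronecker product.\<close>

definition kron :: "complex mat \<Rightarrow> complex mat \<Rightarrow> complex mat" where
  "kron A B = mat (dim_row A * dim_row B) (dim_col A * dim_col B)
     (\<lambda>(i, j). A $$ (i div dim_row B, j div dim_col B) * B $$ (i mod dim_row B, j mod dim_col B))"

text \<open>The operator \<open>I \<otimes> \<dots> \<otimes> K \<otimes> \<dots> \<otimes> I\<close> with \<open>K\<close> at party \<open>k\<close>. If \<open>K\<close> is not square, it maps into
  the system with dimensions \<open>ds[k := dim_row K]\<close>.\<close>

definition local_op :: "nat list \<Rightarrow> nat \<Rightarrow> complex mat \<Rightarrow> complex mat" where
  "local_op ds k K =
     kron (1\<^sub>m (prod_list (take k ds))) (kron K (1\<^sub>m (prod_list (drop (Suc k) ds))))"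

definition mat_trace :: "complex mat \<Rightarrow> complex" where
  "mat_trace A = (\<Sum>i<dim_row A. A $$ (i, i))"

definition mat_sum :: "nat \<Rightarrow> ('i \<Rightarrow> complex mat) \<Rightarrow> 'i set \<Rightarrow> complex mat" where
  "mat_sum n A I = mat n n (\<lambda>ij. \<Sum>i\<in>I. A i $$ ij)"

text \<open>The order on \<^typ>\<open>complex\<close> makes \<open>0 \<le> z\<close> say that \<open>z\<close> is real and nonnegative, so
  that Hermiticity is included.\<close>

definition pos_semidef :: "nat \<Rightarrow> complex mat \<Rightarrow> bool" where
  "pos_semidef n A \<longleftrightarrow> A \<in> carrier_mat n n \<and> (\<forall>v\<in>carrier_vec n. 0 \<le> (A *\<^sub>v v) \<bullet>c v)"

definition density_operator :: "nat \<Rightarrow> complex mat \<Rightarrow> bool" where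
  "density_operator n \<rho> \<longleftrightarrow> pos_semidef n \<rho> \<and> mat_trace \<rho> = 1"

definition is_povm :: "nat \<Rightarrow> 'o set \<Rightarrow> ('o \<Rightarrow> complex mat) \<Rightarrow> bool" where
  "is_povm n \<Omega> M \<longleftrightarrow> finite \<Omega> \<and> (\<forall>x\<in>\<Omega>. pos_semidef n (M x)) \<and> mat_sum n M \<Omega> = 1\<^sub>m n"

text \<open>A protocol is a finite tree. At a node \<open>Measure k bs\<close>, party \<open>k\<close> performs the measurement whose
  outcomes \<open>i\<close> have the Kraus operators \<open>fst (bs ! i)\<close>, and communicates \<open>i\<close> to everybody; the
  protocol then continues with \<open>snd (bs ! i)\<close>. A leaf carries the final classical output, so
  classical post-processing is the choice of leaf labels. The output dimension of a Kraus operator is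
  arbitrary, so ancillas may be attached. Further operations are special cases: a coarse-grained
  local instrument has the same continuation at all Kraus operators of one outcome, and
  local or shared randomness comes from Kraus operators proportional to the identity.\<close>

datatype 'o protocol =
  Announce 'o
| Measure nat "(complex mat \<times> 'o protocol) list"

definition local_measurement :: "nat \<Rightarrow> complex mat list \<Rightarrow> bool" where
  "local_measurement d Ks \<longleftrightarrow>
     (\<forall>K\<in>set Ks. 0 < dim_row K \<and> dim_col K = d) \<and>
     mat_sum d (\<lambda>i. mat_adjoint (Ks ! i) * (Ks ! i)) {..<length Ks} = 1\<^sub>m d"

fun valid_protocol :: "nat list \<Rightarrow> 'o protocol \<Rightarrow> bool" where
  "valid_protocol ds (Announce y) \<longleftrightarrow> True"
| "valid_protocol ds (Measure k bs) \<longleftrightarrow>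
     k < length ds \<and> local_measurement (ds ! k) (map fst bs) \<and>
     (\<forall>(K, P)\<in>set bs. valid_protocol (ds[k := dim_row K]) P)"

text \<open>States are propagated without normalisation, so the trace at a leaf is the probability of
  reaching it.\<close>

fun outcome_prob :: "nat list \<Rightarrow> 'o protocol \<Rightarrow> complex mat \<Rightarrow> 'o \<Rightarrow> complex" where
  "outcome_prob ds (Announce y) \<rho> x = (if x = y then mat_trace \<rho> else 0)"
| "outcome_prob ds (Measure k bs) \<rho> x =
     (\<Sum>(K, P)\<leftarrow>bs. outcome_prob (ds[k := dim_row K]) P
        (local_op ds k K * \<rho> * mat_adjoint (local_op ds k K)) x)"

definition LOCC_povm :: "nat list \<Rightarrow> 'o set \<Rightarrow> ('o \<Rightarrow> complex mat) \<Rightarrow> bool" where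
  "LOCC_povm ds \<Omega> M \<longleftrightarrow>
     is_povm (prod_list ds) \<Omega> M \<and>
     (\<exists>P. valid_protocol ds P \<and>
       (\<forall>\<rho>. density_operator (prod_list ds) \<rho> \<longrightarrow>
         (\<forall>x\<in>\<Omega>. outcome_prob ds P \<rho> x = mat_trace (M x * \<rho>))))"

definition multipartite_system :: "nat list \<Rightarrow> bool" where
  "multipartite_system ds \<longleftrightarrow> 2 \<le> length ds \<and> (\<forall>d\<in>set ds. 1 \<le> d)"

definition orthogonal_states :: "nat list \<Rightarrow> complex mat set \<Rightarrow> bool" where
  "orthogonal_states ds S \<longleftrightarrow>
     (\<forall>\<rho>\<in>S. density_operator (prod_list ds) \<rho>) \<and>
     (\<forall>\<rho>\<in>S. \<forall>\<sigma>\<in>S. \<rho> \<noteq> \<sigma> \<longrightarrow> mat_trace (\<rho> * \<sigma>) = 0)"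

text \<open>The outcome \<open>Some \<rho>\<close> means that the state is identified as \<open>\<rho>\<close>; \<open>None\<close> is inconclusive.\<close>

definition conclusively_discriminable :: "nat list \<Rightarrow> complex mat set \<Rightarrow> bool" where
  "conclusively_discriminable ds S \<longleftrightarrow>
     (\<exists>M. LOCC_povm ds (insert None (Some ` S)) M \<and>
       (\<forall>\<rho>\<in>S. \<forall>\<sigma>\<in>S. \<rho> \<noteq> \<sigma> \<longrightarrow> mat_trace (M (Some \<rho>) * \<sigma>) = 0) \<and>
       0 < 1 / real (card S) * (\<Sum>\<rho>\<in>S. Re (mat_trace (M (Some \<rho>) * \<rho>))))"

datatype answer = Yes | No | Inconclusive

definition conclusively_answerable :: "nat list \<Rightarrow> complex mat set \<Rightarrow> complex mat \<Rightarrow> bool" where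
  "conclusively_answerable ds S \<rho> \<longleftrightarrow>
     (\<exists>M. LOCC_povm ds {Yes, No, Inconclusive} M \<and>
       (\<forall>\<sigma>\<in>S. \<sigma> \<noteq> \<rho> \<longrightarrow> mat_trace (M Yes * \<sigma>) = 0) \<and>
       mat_trace (M No * \<rho>) = 0 \<and>
       0 < 1 / real (card S) * (\<Sum>\<sigma>\<in>S. Re (mat_trace ((M Yes + M No) * \<sigma>))))"

definition conclusive_LRA :: "nat list \<Rightarrow> complex mat set \<Rightarrow> bool" where
  "conclusive_LRA ds S \<longleftrightarrow> (\<forall>\<rho>\<in>S. conclusively_answerable ds S \<rho>)"

end

theory Submission
  imports Defs
begin

text \<open>A discriminating protocol answers the question about \<open>\<rho>\<close> after relabelling its outcomes: \<open>\<rho>\<close>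
  becomes ``yes'', every other state becomes ``no''.

  For the converse take the Bell basis of two qubits. The local measurement outcome \<open>|00\<rangle>\<close> excludes
  the two odd Bell states and \<open>|01\<rangle>\<close> the two even ones, which gives ``no'' answers to all questions.
  On the other hand every branch of an LOCC protocol acts as a product operator
  \<open>A \<otimes> B\<close>, and a product operator that annihilates three Bell vectors annihilates the fourth as well,
  so no branch can identify a state without error.\<close>

subsection \<open>Adjoints, traces and Kronecker products\<close>

lemma mat_adjoint_dim [simp]: "dim_row (mat_adjoint A) = dim_col A" "dim_col (mat_adjoint A) = dim_row A"
  by (simp_all add: mat_adjoint_def)

lemma mat_adjoint_carrier [simp]: "A \<in> carrier_mat n m \<Longrightarrow> mat_adjoint A \<in> carrier_mat m n"
  by (intro carrier_matI) simp_all

lemma mat_adjoint_index [simp]: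
  "i < dim_col A \<Longrightarrow> j < dim_row A \<Longrightarrow> mat_adjoint A $$ (i, j) = conjugate (A $$ (j, i))"
  by (simp add: mat_adjoint_def mat_of_rows_def)

text \<open>Entries as sums over an initial segment, the shape in which sums are swapped and split.
  The simp rule \<open>index_mult_mat(1)\<close> would produce scalar products instead, so it is
  deleted wherever this lemma is used.\<close>

lemma mat_mult_index:
  "i < dim_row A \<Longrightarrow> j < dim_col B \<Longrightarrow> dim_row B = dim_col A \<Longrightarrow>
    (A * B) $$ (i, j) = (\<Sum>k<dim_col A. A $$ (i, k) * B $$ (k, j))"
  by (simp add: scalar_prod_def atLeast0LessThan)

lemma mat_adjoint_mult:
  fixes A B :: "complex mat"
  assumes "dim_col A = dim_row B"
  shows "mat_adjoint (A * B) = mat_adjoint B * mat_adjoint A"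
proof (intro eq_matI)
  fix i j
  assume "i < dim_row (mat_adjoint B * mat_adjoint A)" "j < dim_col (mat_adjoint B * mat_adjoint A)"
  then show "mat_adjoint (A * B) $$ (i, j) = (mat_adjoint B * mat_adjoint A) $$ (i, j)"
    using assms by (simp add: mat_mult_index mult.commute cnj_sum del: index_mult_mat(1))
qed simp_all

text \<open>Stated for rectangular factors, since Kraus operators may change the dimension.\<close>

lemma mat_trace_comm:
  assumes "A \<in> carrier_mat n m" "B \<in> carrier_mat m n"
  shows "mat_trace (A * B) = mat_trace (B * A)"
proof -
  have "mat_trace (A * B) = (\<Sum>i<n. \<Sum>k<m. A $$ (i, k) * B $$ (k, i))"
    unfolding mat_trace_def using assms by (auto simp: mat_mult_index simp del: index_mult_mat(1))
  also have "\<dots> = (\<Sum>k<m. \<Sum>i<n. B $$ (k, i) * A $$ (i, k))"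
    by (subst sum.swap) (simp add: mult.commute)
  also have "\<dots> = mat_trace (B * A)"
    unfolding mat_trace_def using assms by (auto simp: mat_mult_index simp del: index_mult_mat(1))
  finally show ?thesis .
qed

lemma mat_sum_dim [simp]: "dim_row (mat_sum n A I) = n" "dim_col (mat_sum n A I) = n"
  by (simp_all add: mat_sum_def)

lemma mat_sum_carrier [simp]: "mat_sum n A I \<in> carrier_mat n n"
  by (intro carrier_matI) simp_all

lemma mat_sum_index [simp]:
  "i < n \<Longrightarrow> j < n \<Longrightarrow> mat_sum n A I $$ (i, j) = (\<Sum>x\<in>I. A x $$ (i, j))"
  by (simp add: mat_sum_def)

lemma mat_trace_mult_right:
  assumes "A \<in> carrier_mat n n" "R \<in> carrier_mat n n"
  shows "mat_trace (A * R) = (\<Sum>i<n. \<Sum>k<n. A $$ (i, k) * R $$ (k, i))"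
  unfolding mat_trace_def using assms by (auto simp: mat_mult_index simp del: index_mult_mat(1))

lemma mat_trace_add_mult:
  assumes "A \<in> carrier_mat n n" "B \<in> carrier_mat n n" "R \<in> carrier_mat n n"
  shows "mat_trace ((A + B) * R) = mat_trace (A * R) + mat_trace (B * R)"
  using assms by (simp add: mat_trace_mult_right[of _ n] distrib_right sum.distrib)

lemma mat_trace_mat_sum_mult:
  assumes "\<forall>x\<in>I. A x \<in> carrier_mat n n" "R \<in> carrier_mat n n"
  shows "mat_trace (mat_sum n A I * R) = (\<Sum>x\<in>I. mat_trace (A x * R))"
proof -
  have "mat_trace (mat_sum n A I * R) = (\<Sum>i<n. \<Sum>k<n. \<Sum>x\<in>I. A x $$ (i, k) * R $$ (k, i))"
    using assms by (simp add: mat_trace_mult_right[of _ n] sum_distrib_right)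
  also have "\<dots> = (\<Sum>x\<in>I. \<Sum>i<n. \<Sum>k<n. A x $$ (i, k) * R $$ (k, i))"
    by (simp add: sum.swap[of _ _ I])
  also have "\<dots> = (\<Sum>x\<in>I. mat_trace (A x * R))"
    using assms by (intro sum.cong) (auto simp: mat_trace_mult_right[of _ n])
  finally show ?thesis .
qed

section \<open>Kronecker products\<close>

text \<open>The range is cut into \<open>a\<close> blocks of length \<open>b\<close>, with
  \<open>k = x * b + y\<close> in block \<open>x\<close>. This splits the contracted index of a
  product of Kronecker products.\<close>

lemma sum_div_mod:
  fixes f :: "nat \<Rightarrow> nat \<Rightarrow> 'a::comm_monoid_add"
  shows "(\<Sum>k<a * b. f (k div b) (k mod b)) = (\<Sum>x<a. \<Sum>y<b. f x y)"
proof -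
  have "(\<Sum>x<a. \<Sum>y<b. f x y) = (\<Sum>x<a. \<Sum>k=x * b..<x * b + b. f (k div b) (k mod b))"
  proof (rule sum.cong[OF refl])
    fix x
    have "(\<Sum>k=x * b..<x * b + b. f (k div b) (k mod b)) =
        (\<Sum>y<b. f ((x * b + y) div b) ((x * b + y) mod b))"
      using sum.shift_bounds_nat_ivl[of "\<lambda>k. f (k div b) (k mod b)" 0 "x * b" b]
      by (simp add: atLeast0LessThan add.commute)
    also have "\<dots> = (\<Sum>y<b. f x y)" by (intro sum.cong) auto
    finally show "(\<Sum>y<b. f x y) = (\<Sum>k=x * b..<x * b + b. f (k div b) (k mod b))" by simp
  qed
  then show ?thesis by (simp add: sum.nat_group)
qed

lemma kron_dim [simp]:
  "dim_row (kron A B) = dim_row A * dim_row B" "dim_col (kron A B) = dim_col A * dim_col B"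
  by (simp_all add: kron_def)

lemma kron_index [simp]:
  "i < dim_row A * dim_row B \<Longrightarrow> j < dim_col A * dim_col B \<Longrightarrow>
    kron A B $$ (i, j) = A $$ (i div dim_row B, j div dim_col B) * B $$ (i mod dim_row B, j mod dim_col B)"
  by (simp add: kron_def)

lemma div_mod_less_mult:
  fixes i a b :: nat
  assumes "i < a * b"
  shows "i div b < a" "i mod b < b"
  using assms by (simp add: less_mult_imp_div_less, cases "b = 0", auto)

text \<open>The mixed-product property: the contracted index becomes a pair, and the double sum
  factors.\<close>

lemma kron_mult:
  assumes "dim_col A = dim_row C" "dim_col B = dim_row D"
  shows "kron A B * kron C D = kron (A * C) (B * D)"
proof (intro eq_matI)
  fix i j
  assume ij: "i < dim_row (kron (A * C) (B * D))" "j < dim_col (kron (A * C) (B * D))"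
  define i1 i2 j1 j2 where ij_defs: "i1 = i div dim_row B" "i2 = i mod dim_row B"
      "j1 = j div dim_col D" "j2 = j mod dim_col D"
  have lt: "i1 < dim_row A" "i2 < dim_row B" "j1 < dim_col C" "j2 < dim_col D"
    using ij unfolding ij_defs by (auto simp: div_mod_less_mult)
  let ?q = "dim_row D"
  have "(kron A B * kron C D) $$ (i, j) = (\<Sum>k<dim_row C * ?q.
      A $$ (i1, k div ?q) * B $$ (i2, k mod ?q) * (C $$ (k div ?q, j1) * D $$ (k mod ?q, j2)))"
    using ij assms unfolding ij_defs by (simp add: mat_mult_index del: index_mult_mat(1))
  also have "\<dots> = (\<Sum>x<dim_row C. \<Sum>y<?q. A $$ (i1, x) * B $$ (i2, y) * (C $$ (x, j1) * D $$ (y, j2)))"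
    by (rule sum_div_mod)
  also have "\<dots> = (A * C) $$ (i1, j1) * (B * D) $$ (i2, j2)"
    using lt assms by (simp add: mat_mult_index sum_product ac_simps del: index_mult_mat(1))
  also have "\<dots> = kron (A * C) (B * D) $$ (i, j)"
    using ij unfolding ij_defs by simp
  finally show "(kron A B * kron C D) $$ (i, j) = kron (A * C) (B * D) $$ (i, j)" .
qed auto

lemma mat_adjoint_kron: "mat_adjoint (kron A B) = kron (mat_adjoint A) (mat_adjoint B)"
  by (intro eq_matI) (auto simp: div_mod_less_mult)

lemma mat_adjoint_one [simp]: "mat_adjoint (1\<^sub>m n :: complex mat) = 1\<^sub>m n"
  by (intro eq_matI) auto

lemma kron_one_one: "kron (1\<^sub>m a) (1\<^sub>m b) = 1\<^sub>m (a * b)"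
proof (intro eq_matI)
  fix i j
  assume "i < dim_row (1\<^sub>m (a * b) :: complex mat)" "j < dim_col (1\<^sub>m (a * b) :: complex mat)"
  moreover have "i = j" if "i div b = j div b" "i mod b = j mod b"
    using that by (metis div_mult_mod_eq)
  ultimately show "kron (1\<^sub>m a) (1\<^sub>m b) $$ (i, j) = 1\<^sub>m (a * b) $$ (i, j)"
    by (auto simp: div_mod_less_mult)
qed auto

text \<open>The dimension is written \<open>Suc 0\<close> because simp normalises 1 to this form.
  Such trivial factors arise in \<open>local_op\<close> at the first and last party.\<close>

lemma kron_one_left [simp]: "kron (1\<^sub>m (Suc 0)) A = A"
  by (intro eq_matI) auto

lemma kron_one_right [simp]: "kron A (1\<^sub>m (Suc 0)) = A"
  by (intro eq_matI) auto

lemma mat_sum_kron_left: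
  assumes A: "\<And>x. x \<in> I \<Longrightarrow> dim_row (A x) = n" "\<And>x. x \<in> I \<Longrightarrow> dim_col (A x) = n"
    and B: "dim_row B = m" "dim_col B = m"
  shows "mat_sum (n * m) (\<lambda>x. kron (A x) B) I = kron (mat_sum n A I) B"
proof (intro eq_matI)
  fix i j
  assume "i < dim_row (kron (mat_sum n A I) B)" "j < dim_col (kron (mat_sum n A I) B)"
  then have ij: "i < n * m" "j < n * m" using B by simp_all
  note lt = div_mod_less_mult[OF ij(1)] div_mod_less_mult[OF ij(2)]
  have "mat_sum (n * m) (\<lambda>x. kron (A x) B) I $$ (i, j) = (\<Sum>x\<in>I. A x $$ (i div m, j div m) * B $$ (i mod m, j mod m))"
    unfolding mat_sum_index[OF ij] by (rule sum.cong[OF refl]) (simp add: A B ij)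
  also have "\<dots> = kron (mat_sum n A I) B $$ (i, j)"
    using ij lt B by (simp add: sum_distrib_right)
  finally show "mat_sum (n * m) (\<lambda>x. kron (A x) B) I $$ (i, j) = kron (mat_sum n A I) B $$ (i, j)" .
qed (simp_all add: B)

lemma mat_sum_kron_right:
  assumes A: "\<And>x. x \<in> I \<Longrightarrow> dim_row (A x) = n" "\<And>x. x \<in> I \<Longrightarrow> dim_col (A x) = n"
    and B: "dim_row B = m" "dim_col B = m"
  shows "mat_sum (m * n) (\<lambda>x. kron B (A x)) I = kron B (mat_sum n A I)"
proof (intro eq_matI)
  fix i j
  assume "i < dim_row (kron B (mat_sum n A I))" "j < dim_col (kron B (mat_sum n A I))"
  then have ij: "i < m * n" "j < m * n" using B by simp_all
  note lt = div_mod_less_mult[OF ij(1)] div_mod_less_mult[OF ij(2)]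
  have "mat_sum (m * n) (\<lambda>x. kron B (A x)) I $$ (i, j) = (\<Sum>x\<in>I. B $$ (i div n, j div n) * A x $$ (i mod n, j mod n))"
    unfolding mat_sum_index[OF ij] by (rule sum.cong[OF refl]) (simp add: A B ij)
  also have "\<dots> = kron B (mat_sum n A I) $$ (i, j)"
    using ij lt B by (simp add: sum_distrib_left)
  finally show "mat_sum (m * n) (\<lambda>x. kron B (A x)) I $$ (i, j) = kron B (mat_sum n A I) $$ (i, j)" .
qed (simp_all add: B)

section \<open>Local operators on the joint space\<close>

lemma prod_list_take_drop:
  fixes ds :: "nat list"
  shows "k < length ds \<Longrightarrow> prod_list (take k ds) * (ds ! k * prod_list (drop (Suc k) ds)) = prod_list ds"
  \<comment> \<open>Only the fourth occurrence of \<open>ds\<close>, the one on the right-hand side,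
    is split at \<open>k\<close>.\<close>
  by (subst (4) id_take_nth_drop[of k ds]) simp_all

text \<open>The output dimension comes from factoring \<open>prod_list\<close> for the updated list,
  which agrees with \<open>ds\<close> before and after position \<open>k\<close>.\<close>

lemma local_op_dim:
  assumes "k < length ds"
  shows "dim_row (local_op ds k K) = prod_list (ds[k := dim_row K])"
    and "dim_col K = ds ! k \<Longrightarrow> dim_col (local_op ds k K) = prod_list ds"
  using assms prod_list_take_drop[of k "ds[k := dim_row K]"] prod_list_take_drop[of k ds]
  by (simp_all add: local_op_def)

text \<open>Each summand is \<open>mat_adjoint K * K\<close> padded with identities. Pulling the sum
  into the middle tensor factor reduces the claim to completeness of the local measurement.\<close>

lemma sum_local_op_adjoint:
  assumes k: "k < length ds" and Ks: "local_measurement (ds ! k) Ks"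
  shows "mat_sum (prod_list ds)
    (\<lambda>i. mat_adjoint (local_op ds k (Ks ! i)) * local_op ds k (Ks ! i)) {..<length Ks} = 1\<^sub>m (prod_list ds)"
proof -
  let ?a = "prod_list (take k ds)" and ?b = "prod_list (drop (Suc k) ds)"
  let ?G = "\<lambda>i. mat_adjoint (Ks ! i) * Ks ! i"
  have col: "dim_col (Ks ! i) = ds ! k" if "i < length Ks" for i
    using Ks that by (auto simp: local_measurement_def)
  have "mat_adjoint (local_op ds k (Ks ! i)) * local_op ds k (Ks ! i) =
      kron (1\<^sub>m ?a) (kron (?G i) (1\<^sub>m ?b))" for i
    by (simp add: local_op_def mat_adjoint_kron kron_mult)
  then have "mat_sum (prod_list ds)
      (\<lambda>i. mat_adjoint (local_op ds k (Ks ! i)) * local_op ds k (Ks ! i)) {..<length Ks} =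
    mat_sum (?a * (ds ! k * ?b)) (\<lambda>i. kron (1\<^sub>m ?a) (kron (?G i) (1\<^sub>m ?b))) {..<length Ks}"
    using prod_list_take_drop[OF k] by simp
  also have "\<dots> = kron (1\<^sub>m ?a) (mat_sum (ds ! k * ?b) (\<lambda>i. kron (?G i) (1\<^sub>m ?b)) {..<length Ks})"
    using col by (intro mat_sum_kron_right) auto
  also have "mat_sum (ds ! k * ?b) (\<lambda>i. kron (?G i) (1\<^sub>m ?b)) {..<length Ks} =
      kron (mat_sum (ds ! k) ?G {..<length Ks}) (1\<^sub>m ?b)"
    using col by (intro mat_sum_kron_left) auto
  also have "mat_sum (ds ! k) ?G {..<length Ks} = 1\<^sub>m (ds ! k)"
    using Ks by (simp add: local_measurement_def)
  finally show ?thesis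
    using prod_list_take_drop[OF k] by (simp add: kron_one_one)
qed

subsection \<open>Total probability and relabelling of protocols\<close>

text \<open>Cyclicity of the trace moves both Kraus factors to the left of \<open>R\<close>, where
  they sum to the identity.\<close>

lemma trace_local_measurement:
  assumes k: "k < length ds" and Ks: "local_measurement (ds ! k) Ks"
    and R: "R \<in> carrier_mat (prod_list ds) (prod_list ds)"
  shows "(\<Sum>K\<leftarrow>Ks. mat_trace (local_op ds k K * R * mat_adjoint (local_op ds k K))) = mat_trace R"
proof -
  let ?n = "prod_list ds"
  define L where "L i = local_op ds k (Ks ! i)" for i
  have col: "dim_col (L i) = ?n" if "i < length Ks" for i
    unfolding L_def using Ks that k by (intro local_op_dim) (auto simp: local_measurement_def)
  have cyc: "mat_trace (L i * R * mat_adjoint (L i)) = mat_trace (mat_adjoint (L i) * L i * R)"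
    if i: "i < length Ks" for i
  proof -
    obtain m where L: "L i \<in> carrier_mat m ?n" using col[OF i] by blast
    then have La: "mat_adjoint (L i) \<in> carrier_mat ?n m" by simp
    have "mat_trace (L i * R * mat_adjoint (L i)) = mat_trace (mat_adjoint (L i) * (L i * R))"
      by (rule mat_trace_comm[OF _ La]) (use L R in auto)
    then show ?thesis using assoc_mult_mat[OF La L R] by simp
  qed
  have "(\<Sum>K\<leftarrow>Ks. mat_trace (local_op ds k K * R * mat_adjoint (local_op ds k K))) =
      (\<Sum>i<length Ks. mat_trace (L i * R * mat_adjoint (L i)))"
    by (simp add: sum_list_sum_nth L_def atLeast0LessThan)
  also have "\<dots> = (\<Sum>i<length Ks. mat_trace (mat_adjoint (L i) * L i * R))"
    using cyc by (intro sum.cong) auto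
  also have "\<dots> = mat_trace (mat_sum ?n (\<lambda>i. mat_adjoint (L i) * L i) {..<length Ks} * R)"
    using col R by (subst mat_trace_mat_sum_mult) auto
  also have "\<dots> = mat_trace R"
    using sum_local_op_adjoint[OF k Ks] R by (simp add: L_def)
  finally show ?thesis .
qed

lemma sum_sum_list: "(\<Sum>x\<in>T. \<Sum>b\<leftarrow>bs. f x b) = (\<Sum>b\<leftarrow>bs. \<Sum>x\<in>T. f x (b :: 'b) :: 'a::comm_monoid_add)"
  by (induction bs) (simp_all add: sum.distrib)

text \<open>Every node preserves the total trace, and no leaf is lost because all labels lie in
  \<open>T\<close>. Normalisation of \<open>R\<close> is not assumed, as intermediate states are
  unnormalised.\<close>

lemma sum_outcome_prob:
  assumes "valid_protocol ds P" "R \<in> carrier_mat (prod_list ds) (prod_list ds)"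
    and "finite T" "set_protocol P \<subseteq> T"
  shows "(\<Sum>x\<in>T. outcome_prob ds P R x) = mat_trace R"
  using assms
proof (induction P arbitrary: ds R)
  case (Announce y)
  then show ?case by simp
next
  case (Measure k bs)
  let ?R = "\<lambda>K. local_op ds k K * R * mat_adjoint (local_op ds k K)"
  have k: "k < length ds" and m: "local_measurement (ds ! k) (map fst bs)"
    using Measure.prems by auto
  have IH: "(\<Sum>x\<in>T. outcome_prob (ds[k := dim_row K]) P (?R K) x) = mat_trace (?R K)"
    if "(K, P) \<in> set bs" for K P
  proof (rule Measure.IH[OF that])
    \<comment> \<open>The induction rule of the nested datatype reaches subprotocols through the set
      function of the pair type.\<close>
    show "P \<in> Basic_BNFs.snds (K, P)" by (simp add: prod_set_defs)
    show "valid_protocol (ds[k := dim_row K]) P" using Measure.prems(1) that by auto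
    have "dim_row (local_op ds k K) = prod_list (ds[k := dim_row K])"
      using k by (rule local_op_dim)
    then show "?R K \<in> carrier_mat (prod_list (ds[k := dim_row K])) (prod_list (ds[k := dim_row K]))"
      by (metis carrier_matI index_mult_mat(2,3) mat_adjoint_dim(2))
    show "set_protocol P \<subseteq> T" using Measure.prems(4) that by (force simp: prod_set_defs)
  qed fact
  have "(\<Sum>x\<in>T. outcome_prob ds (Measure k bs) R x) = (\<Sum>b\<leftarrow>bs. mat_trace (?R (fst b)))"
    unfolding outcome_prob.simps sum_sum_list using IH
    by (intro arg_cong[where f = sum_list] map_cong) (auto simp: case_prod_beta)
  also have "\<dots> = mat_trace R"
    using trace_local_measurement[OF k m Measure.prems(2)] by (simp add: comp_def)
  finally show ?case .
qed

lemma valid_map_protocol: "valid_protocol ds P \<Longrightarrow> valid_protocol ds (map_protocol f P)"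
proof (induction P arbitrary: ds)
  case (Measure k bs)
  have "valid_protocol (ds[k := dim_row K]) (map_protocol f P)" if "(K, P) \<in> set bs" for K P
    using Measure.prems that by (intro Measure.IH[OF that]) (auto simp: prod_set_defs)
  then show ?case using Measure.prems by (auto simp: comp_def)
qed simp

text \<open>Relabelling adds the probabilities over each fibre of \<open>f\<close>. The finite set
  \<open>T\<close> keeps the fibres finite even if the label type is infinite.\<close>

lemma outcome_prob_map_protocol:
  assumes "finite T" "set_protocol P \<subseteq> T"
  shows "outcome_prob ds (map_protocol f P) R x = (\<Sum>y\<in>{y\<in>T. f y = x}. outcome_prob ds P R y)"
  using assms
proof (induction P arbitrary: ds R)
  case (Announce y)
  then have "{z \<in> T. f z = x} \<inter> {y} = (if x = f y then {y} else {})" by auto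
  then show ?case using Announce by (simp add: sum.If_cases)
next
  case (Measure k bs)
  let ?R = "\<lambda>K. local_op ds k K * R * mat_adjoint (local_op ds k K)"
  have IH: "outcome_prob ds' (map_protocol f P) R' x = (\<Sum>y\<in>{y\<in>T. f y = x}. outcome_prob ds' P R' y)"
    if "(K, P) \<in> set bs" for K P ds' R'
  proof (rule Measure.IH[OF that])
    show "P \<in> Basic_BNFs.snds (K, P)" by (simp add: prod_set_defs)
    show "set_protocol P \<subseteq> T" using Measure.prems(2) that by (force simp: prod_set_defs)
  qed fact
  show ?case
    unfolding protocol.map outcome_prob.simps sum_sum_list map_map using IH
    by (intro arg_cong[where f = sum_list] map_cong) (auto simp: case_prod_beta)
qed

subsection \<open>From discrimination to authentication\<close>

lemma quadratic_form_index:
  assumes "A \<in> carrier_mat n n" "v \<in> carrier_vec n"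
  shows "(A *\<^sub>v v) \<bullet>c v = (\<Sum>i<n. \<Sum>j<n. A $$ (i, j) * v $ j * conjugate (v $ i))"
  using assms by (simp add: scalar_prod_def sum_distrib_right atLeast0LessThan)

lemma pos_semidef_mat_sum:
  assumes "\<forall>x\<in>I. pos_semidef n (A x)"
  shows "pos_semidef n (mat_sum n A I)"
  unfolding pos_semidef_def
proof (intro conjI ballI)
  fix v :: "complex vec"
  assume v: "v \<in> carrier_vec n"
  have "(mat_sum n A I *\<^sub>v v) \<bullet>c v =
      (\<Sum>i<n. \<Sum>j<n. \<Sum>x\<in>I. A x $$ (i, j) * v $ j * conjugate (v $ i))"
    using v by (simp add: quadratic_form_index[of _ n] sum_distrib_right)
  also have "\<dots> = (\<Sum>x\<in>I. \<Sum>i<n. \<Sum>j<n. A x $$ (i, j) * v $ j * conjugate (v $ i))"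
    by (simp add: sum.swap[of _ _ I])
  also have "\<dots> = (\<Sum>x\<in>I. (A x *\<^sub>v v) \<bullet>c v)"
    using assms v by (intro sum.cong refl quadratic_form_index[symmetric]) (auto simp: pos_semidef_def)
  also have "0 \<le> \<dots>"
    using assms v by (intro sum_nonneg) (auto simp: pos_semidef_def)
  finally show "0 \<le> (mat_sum n A I *\<^sub>v v) \<bullet>c v" .
qed simp

lemma finite_set_protocol: "finite (set_protocol P)"
  by (induction P) (auto simp: prod_set_defs)

lemma conclusively_answerable_if_discriminable:
  assumes fin: "finite S" and orth: "orthogonal_states ds S"
    and disc: "conclusively_discriminable ds S" and \<rho>: "\<rho> \<in> S"
  shows "conclusively_answerable ds S \<rho>"
proof -
  let ?n = "prod_list ds"
  obtain M where M: "LOCC_povm ds (insert None (Some ` S)) M \<and>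
      (\<forall>\<sigma>\<in>S. \<forall>\<tau>\<in>S. \<sigma> \<noteq> \<tau> \<longrightarrow> mat_trace (M (Some \<sigma>) * \<tau>) = 0) \<and>
      0 < 1 / real (card S) * (\<Sum>\<sigma>\<in>S. Re (mat_trace (M (Some \<sigma>) * \<sigma>)))"
    using disc unfolding conclusively_discriminable_def by (rule exE)
  note locc = conjunct1[OF M] and pos = conjunct2[OF conjunct2[OF M]]
  have zero: "mat_trace (M (Some \<sigma>) * \<tau>) = 0" if "\<sigma> \<in> S" "\<tau> \<in> S" "\<sigma> \<noteq> \<tau>" for \<sigma> \<tau>
    using conjunct1[OF conjunct2[OF M]] that by simp
  obtain P where povm: "is_povm ?n (insert None (Some ` S)) M"
    and P: "valid_protocol ds P"
    and prob: "\<And>R x. density_operator ?n R \<Longrightarrow> x \<in> insert None (Some ` S) \<Longrightarrow>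
      outcome_prob ds P R x = mat_trace (M x * R)"
    using locc unfolding LOCC_povm_def by metis
  have psd: "pos_semidef ?n (M x)" if "x \<in> insert None (Some ` S)" for x
    using povm that by (auto simp: is_povm_def)
  have car: "M x \<in> carrier_mat ?n ?n" if "x \<in> insert None (Some ` S)" for x
    using psd[OF that] by (simp add: pos_semidef_def)
  have dens: "density_operator ?n \<sigma>" if "\<sigma> \<in> S" for \<sigma>
    using orth that by (auto simp: orthogonal_states_def)
  have car_dens: "R \<in> carrier_mat ?n ?n" if "density_operator ?n R" for R
    using that by (simp add: density_operator_def pos_semidef_def)
  define M' where "M' = (\<lambda>a. case a of Yes \<Rightarrow> M (Some \<rho>) | Inconclusive \<Rightarrow> M None
    | No \<Rightarrow> mat_sum ?n (\<lambda>\<sigma>. M (Some \<sigma>)) (S - {\<rho>}))"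
  \<comment> \<open>Labels outside the POVM may occur in \<open>P\<close>; they have total probability zero and are made inconclusive.\<close>
  define f where "f = (\<lambda>y. if y = Some \<rho> then Yes else if y \<in> Some ` S then No else Inconclusive)"
  have M'_simps: "M' Yes = M (Some \<rho>)" "M' Inconclusive = M None"
    "M' No = mat_sum ?n (\<lambda>\<sigma>. M (Some \<sigma>)) (S - {\<rho>})"
    by (simp_all add: M'_def)
  have psd': "pos_semidef ?n (M' a)" for a
    by (cases a) (use psd \<rho> in \<open>auto simp: M'_simps intro!: pos_semidef_mat_sum\<close>)
  have car': "M' a \<in> carrier_mat ?n ?n" for a
    using psd' by (simp add: pos_semidef_def)
  have sum_M': "mat_sum ?n M' {Yes, No, Inconclusive} = 1\<^sub>m ?n"
  proof -
    have "mat_sum ?n M' {Yes, No, Inconclusive} = mat_sum ?n M (insert None (Some ` S))"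
    proof (intro eq_matI)
      fix i j
      assume "i < dim_row (mat_sum ?n M (insert None (Some ` S)))"
        "j < dim_col (mat_sum ?n M (insert None (Some ` S)))"
      then show "mat_sum ?n M' {Yes, No, Inconclusive} $$ (i, j) =
          mat_sum ?n M (insert None (Some ` S)) $$ (i, j)"
        using fin \<rho> by (simp add: M'_simps sum.reindex sum.remove[of S \<rho>])
    qed simp_all
    then show ?thesis using povm by (simp add: is_povm_def)
  qed
  have trace_No: "mat_trace (M' No * R) = (\<Sum>\<sigma>\<in>S - {\<rho>}. mat_trace (M (Some \<sigma>) * R))"
    if "R \<in> carrier_mat ?n ?n" for R
    unfolding M'_simps using car that by (intro mat_trace_mat_sum_mult) auto
  \<comment> \<open>The fibres must range over all announced labels as well as over all POVM
    outcomes.\<close>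
  let ?T = "set_protocol P \<union> insert None (Some ` S)"
  have T: "finite ?T" "set_protocol P \<subseteq> ?T" using fin by (auto simp: finite_set_protocol)
  let ?P = "map_protocol f P"
  have prob': "outcome_prob ds ?P R a = mat_trace (M' a * R)" if R: "density_operator ?n R" for R a
  proof -
    have Yes: "outcome_prob ds ?P R Yes = mat_trace (M' Yes * R)"
    proof -
      have "{y \<in> ?T. f y = Yes} = {Some \<rho>}" using \<rho> by (auto simp: f_def split: if_splits)
      then show ?thesis
        using prob[OF R] \<rho> unfolding outcome_prob_map_protocol[OF T] by (simp add: M'_simps)
    qed
    have No: "outcome_prob ds ?P R No = mat_trace (M' No * R)"
    proof -
      have "{y \<in> ?T. f y = No} = Some ` (S - {\<rho>})" by (auto simp: f_def split: if_splits)
      then show ?thesis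
        using prob[OF R] unfolding outcome_prob_map_protocol[OF T] trace_No[OF car_dens[OF R]]
        by (simp add: sum.reindex)
    qed
    \<comment> \<open>The fibre of \<open>Inconclusive\<close> may contain labels about which
      \<open>prob\<close> says nothing, so this probability is obtained as the complement of the
      other two.\<close>
    have "(\<Sum>a\<in>{Yes, No, Inconclusive}. outcome_prob ds ?P R a) = mat_trace R"
      using P car_dens[OF R] by (intro sum_outcome_prob valid_map_protocol) (auto intro: answer.exhaust)
    also have "\<dots> = mat_trace (mat_sum ?n M' {Yes, No, Inconclusive} * R)"
      using car_dens[OF R] by (simp add: sum_M')
    also have "\<dots> = (\<Sum>a\<in>{Yes, No, Inconclusive}. mat_trace (M' a * R))"
      using car' car_dens[OF R] by (intro mat_trace_mat_sum_mult) auto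
    finally have "outcome_prob ds ?P R Inconclusive = mat_trace (M' Inconclusive * R)"
      using Yes No by simp
    with Yes No show ?thesis by (cases a) auto
  qed
  have LOCC: "LOCC_povm ds {Yes, No, Inconclusive} M'"
    unfolding LOCC_povm_def is_povm_def
    using psd' sum_M' valid_map_protocol[OF P] prob'
    by (intro conjI ballI exI[of _ ?P] allI impI) auto
  \<comment> \<open>On the state \<open>\<sigma>\<close> a conclusive answer is exactly a conclusive
    identification; by \<open>zero\<close> only the outcome \<open>Some \<sigma>\<close>
    contributes. Hence both success probabilities agree.\<close>
  have "mat_trace ((M' Yes + M' No) * \<sigma>) = mat_trace (M (Some \<sigma>) * \<sigma>)" if \<sigma>: "\<sigma> \<in> S" for \<sigma>
  proof -
    have R: "\<sigma> \<in> carrier_mat ?n ?n" using car_dens[OF dens[OF \<sigma>]] .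
    have "mat_trace ((M' Yes + M' No) * \<sigma>) = (\<Sum>\<tau>\<in>S. mat_trace (M (Some \<tau>) * \<sigma>))"
      unfolding mat_trace_add_mult[OF car'[of Yes] car'[of No] R] trace_No[OF R]
      by (subst sum.remove[OF fin \<rho>]) (simp add: M'_simps)
    also have "\<dots> = mat_trace (M (Some \<sigma>) * \<sigma>)"
      using fin \<sigma> zero by (subst sum.remove[OF fin \<sigma>]) (auto intro!: sum.neutral)
    finally show ?thesis .
  qed
  then have pos': "0 < 1 / real (card S) * (\<Sum>\<sigma>\<in>S. Re (mat_trace ((M' Yes + M' No) * \<sigma>)))"
    using pos by simp
  have "mat_trace (M' No * \<rho>) = 0"
    using trace_No[OF car_dens[OF dens[OF \<rho>]]] zero \<rho> by (auto intro!: sum.neutral)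
  moreover have "\<forall>\<sigma>\<in>S. \<sigma> \<noteq> \<rho> \<longrightarrow> mat_trace (M' Yes * \<sigma>) = 0"
    using zero \<rho> by (auto simp: M'_simps)
  ultimately show ?thesis
    unfolding conclusively_answerable_def using LOCC pos' by blast
qed

subsection \<open>Product operators on the Bell basis\<close>

text \<open>This is the squared Frobenius norm of \<open>X\<close>, which explains the positivity
  and the vanishing criterion that follow.\<close>

lemma mat_trace_mult_adjoint:
  "mat_trace (X * mat_adjoint X) = (\<Sum>i<dim_row X. \<Sum>k<dim_col X. X $$ (i, k) * conjugate (X $$ (i, k)))"
  by (simp add: mat_trace_def mat_mult_index del: index_mult_mat(1))

lemma mat_trace_mult_adjoint_nonneg: "0 \<le> mat_trace (X * mat_adjoint X)"
  unfolding mat_trace_mult_adjoint by (intro sum_nonneg conjugate_square_positive)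

lemma mat_trace_mult_adjoint_eq_0_iff:
  "mat_trace (X * mat_adjoint X) = 0 \<longleftrightarrow> (\<forall>i<dim_row X. \<forall>k<dim_col X. X $$ (i, k) = 0)"
proof -
  let ?z = "\<lambda>i k. X $$ (i, k) * conjugate (X $$ (i, k))"
  have inner: "(\<Sum>k<dim_col X. ?z i k) = 0 \<longleftrightarrow> (\<forall>k\<in>{..<dim_col X}. ?z i k = 0)" for i
    by (intro sum_nonneg_eq_0_iff finite_lessThan conjugate_square_positive)
  have "(\<Sum>i<dim_row X. \<Sum>k<dim_col X. ?z i k) = 0 \<longleftrightarrow>
      (\<forall>i\<in>{..<dim_row X}. (\<Sum>k<dim_col X. ?z i k) = 0)"
    by (intro sum_nonneg_eq_0_iff finite_lessThan sum_nonneg conjugate_square_positive)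
  then show ?thesis
    unfolding mat_trace_mult_adjoint inner by auto
qed

text \<open>The quadratic form is the squared norm of \<open>mat_adjoint X *\<^sub>v v\<close>,
  whose coordinates are the \<open>z k\<close>.\<close>

lemma pos_semidef_mult_adjoint:
  assumes X: "X \<in> carrier_mat n m"
  shows "pos_semidef n (X * mat_adjoint X)"
  unfolding pos_semidef_def
proof (intro conjI ballI)
  show XX: "X * mat_adjoint X \<in> carrier_mat n n"
    using X mat_adjoint_carrier[OF X] by (rule mult_carrier_mat)
  fix v :: "complex vec"
  assume v: "v \<in> carrier_vec n"
  define z where "z k = (\<Sum>j<n. conjugate (X $$ (j, k)) * v $ j)" for k
  have dims: "dim_row X = n" "dim_col X = m" using X by auto
  have "(X * mat_adjoint X *\<^sub>v v) \<bullet>c v =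
      (\<Sum>i<n. \<Sum>j<n. \<Sum>k<m. X $$ (i, k) * conjugate (X $$ (j, k)) * v $ j * conjugate (v $ i))"
    unfolding quadratic_form_index[OF XX v]
    by (simp add: mat_mult_index dims sum_distrib_right del: index_mult_mat(1))
  also have "\<dots> = (\<Sum>k<m. \<Sum>i<n. \<Sum>j<n. X $$ (i, k) * conjugate (X $$ (j, k)) * v $ j * conjugate (v $ i))"
    by (simp add: sum.swap[of _ "{..<m}"])
  also have "\<dots> = (\<Sum>k<m. z k * conjugate (z k))"
  proof (rule sum.cong[OF refl])
    fix k
    have "conjugate (z k) = (\<Sum>i<n. X $$ (i, k) * conjugate (v $ i))"
      by (simp add: z_def)
    then show "(\<Sum>i<n. \<Sum>j<n. X $$ (i, k) * conjugate (X $$ (j, k)) * v $ j * conjugate (v $ i)) =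
        z k * conjugate (z k)"
      by (subst sum.swap) (simp add: z_def sum_product ac_simps)
  qed
  also have "0 \<le> \<dots>"
    by (intro sum_nonneg conjugate_square_positive)
  finally show "0 \<le> (X * mat_adjoint X *\<^sub>v v) \<bullet>c v" .
qed

text \<open>A Kraus operator keeps the Gram form and merely replaces \<open>X\<close> by
  \<open>L * X\<close>, so inductions over protocols can follow the factor instead of the
  state.\<close>

lemma conjugate_mult_adjoint:
  fixes L X :: "complex mat"
  assumes "dim_col L = dim_row X"
  shows "L * (X * mat_adjoint X) * mat_adjoint L = (L * X) * mat_adjoint (L * X)"
proof -
  obtain n m k where L: "L \<in> carrier_mat n m" and X: "X \<in> carrier_mat m k"
    using assms by blast
  note La = mat_adjoint_carrier[OF L] and Xa = mat_adjoint_carrier[OF X]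
  show ?thesis
    unfolding mat_adjoint_mult[OF assms]
    using assoc_mult_mat[OF L X Xa] assoc_mult_mat[OF mult_carrier_mat[OF L X] Xa La] by simp
qed

text \<open>The traces at the leaves are squared norms. Nonnegativity later forces every branch of a
  vanishing probability to vanish.\<close>

lemma outcome_prob_nonneg:
  assumes "valid_protocol ds P" "dim_row X = prod_list ds"
  shows "0 \<le> outcome_prob ds P (X * mat_adjoint X) x"
  using assms
proof (induction P arbitrary: ds X)
  case (Announce y)
  then show ?case by (simp add: mat_trace_mult_adjoint_nonneg)
next
  case (Measure k bs)
  have "0 \<le> outcome_prob (ds[k := dim_row K]) P
      (local_op ds k K * (X * mat_adjoint X) * mat_adjoint (local_op ds k K)) x"
    if KP: "(K, P) \<in> set bs" for K P
  proof -
    have k: "k < length ds" and K: "dim_col K = ds ! k"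
      using Measure.prems(1) KP by (auto simp: local_measurement_def)
    show ?thesis
      unfolding conjugate_mult_adjoint[OF local_op_dim(2)[OF k K, folded Measure.prems(2)]]
      using Measure.prems(1) KP local_op_dim(1)[OF k]
      by (intro Measure.IH[OF KP]) (auto simp: prod_set_defs)
  qed
  then show ?case by (auto intro!: sum_list_nonneg)
qed

text \<open>The column vector \<open>(|0, a\<rangle> \<plusminus> |1, 1 - a\<rangle>) / \<surd>2\<close>, with the minus sign iff \<open>s\<close>.\<close>

definition bell_vec :: "bool \<Rightarrow> bool \<Rightarrow> complex mat" where
  "bell_vec a s = mat 4 1 (\<lambda>(i, _). if (i = 1 \<or> i = 2) = a
     then (if s \<and> 2 \<le> i then - 1 else 1) / complex_of_real (sqrt 2) else 0)"

definition bell :: "bool \<Rightarrow> bool \<Rightarrow> complex mat" where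
  "bell a s = bell_vec a s * mat_adjoint (bell_vec a s)"

lemma bell_vec_dim [simp]: "dim_row (bell_vec a s) = 4" "dim_col (bell_vec a s) = 1"
  by (simp_all add: bell_vec_def)

lemma lessThan_4: "{..<4 :: nat} = {0, 1, 2, 3}"
  by auto

text \<open>Each parity class, {0, 3} or {1, 2}, has exactly one index from 2 on, so the two signs
  multiply to -1 precisely off the diagonal.\<close>

lemma bell_index:
  assumes "i < 4" "j < 4"
  shows "bell a s $$ (i, j) = (if (i = 1 \<or> i = 2) = a \<and> (j = 1 \<or> j = 2) = a
    then (if s \<and> i \<noteq> j then - 1 else 1) / 2 else 0)"
proof -
  have sqrt2: "complex_of_real (sqrt 2) * complex_of_real (sqrt 2) = 2"
    by (simp flip: of_real_mult)
  \<comment> \<open>Naming the amplitude keeps the square root out of the case analysis, which uses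
    only \<open>ww\<close>.\<close>
  define w where "w = 1 / complex_of_real (sqrt 2)"
  have ww: "w * cnj w = 1 / 2" by (simp add: w_def sqrt2)
  have e: "bell_vec a s $$ (k, 0) =
      (if (k = 1 \<or> k = 2) = a then (if s \<and> 2 \<le> k then - w else w) else 0)" if "k < 4" for k
    using that by (simp add: bell_vec_def w_def)
  have "bell a s $$ (i, j) = bell_vec a s $$ (i, 0) * conjugate (bell_vec a s $$ (j, 0))"
    using assms by (simp add: bell_def mat_mult_index del: index_mult_mat(1))
  moreover have "i \<in> {0, 1, 2, 3}" "j \<in> {0, 1, 2, 3}"
    using assms by auto
  ultimately show ?thesis
    unfolding e[OF assms(1)] e[OF assms(2)] by (auto simp: ww)
qed

lemma bell_carrier: "bell a s \<in> carrier_mat 4 4"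
  unfolding bell_def by (intro carrier_matI) simp_all

lemma mat_trace_bell: "mat_trace (bell a s) = 1"
  using bell_carrier[of a s] by (simp add: mat_trace_def bell_index lessThan_4)

lemma density_bell: "density_operator 4 (bell a s)"
  unfolding density_operator_def mat_trace_bell unfolding bell_def
  by (intro conjI pos_semidef_mult_adjoint[where m = 1] carrier_matI) simp_all

lemma bell_orthogonal: "(a, s) \<noteq> (b, t) \<Longrightarrow> mat_trace (bell a s * bell b t) = 0"
  by (cases a; cases s; cases b; cases t)
    (simp_all add: mat_trace_mult_right[OF bell_carrier bell_carrier] bell_index lessThan_4)

text \<open>Otherwise a Bell state would be orthogonal to itself, although its purity is 1. Outcomes
  are labelled by matrices, so distinct index pairs must give distinct matrices.\<close>

lemma bell_inject: "bell a s = bell b t \<Longrightarrow> (a, s) = (b, t)"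
proof (rule ccontr)
  assume eq: "bell a s = bell b t" and "(a, s) \<noteq> (b, t)"
  then have "mat_trace (bell a s * bell a s) = 0" using bell_orthogonal by metis
  then show False
    by (cases a; cases s)
      (simp_all add: mat_trace_mult_right[OF bell_carrier bell_carrier] bell_index lessThan_4)
qed

text \<open>The amplitudes \<open>g j k = A $$ (_, j) * B $$ (_, k)\<close> of a product operator satisfy
  \<open>g 0 0 * g 1 1 = g 0 1 * g 1 0\<close>. If three of the Bell combinations \<open>g 0 0 \<plusminus> g 1 1\<close>,
  \<open>g 0 1 \<plusminus> g 1 0\<close> vanish, then one of these products is zero, hence both, and all amplitudes vanish.\<close>

lemma kron_bell_vec_zero:
  assumes A: "dim_col A = 2" and B: "dim_col B = 2"
    and ij: "i < dim_row A * dim_row B"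
    and zero: "\<And>b s. (b, s) \<noteq> (a, t) \<Longrightarrow> (kron A B * bell_vec b s) $$ (i, 0) = 0"
  shows "(kron A B * bell_vec a t) $$ (i, 0) = 0"
proof -
  \<comment> \<open>For the fixed row \<open>i\<close> of \<open>kron A B\<close>, these are its
    four entries, indexed by the column pair.\<close>
  define g where "g j k = A $$ (i div dim_row B, j) * B $$ (i mod dim_row B, k)" for j k
  have entry: "(kron A B * bell_vec b s) $$ (i, 0) =
      (if b then g 0 1 + (if s then - 1 else 1) * g 1 0 else g 0 0 + (if s then - 1 else 1) * g 1 1)
        / complex_of_real (sqrt 2)" for b s
    using ij A B
    by (simp add: mat_mult_index g_def bell_vec_def lessThan_4 add_divide_distrib diff_divide_distrib
        del: index_mult_mat(1))
  define h where "h b s = (if b then g 0 1 + (if s then - 1 else 1) * g 1 0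
      else g 0 0 + (if s then - 1 else 1) * g 1 1)" for b s
  have h: "h b s = 0" if "(b, s) \<noteq> (a, t)" for b s
    using zero[OF that] unfolding entry h_def[symmetric] by simp
  have sum_diff: "x = 0 \<and> y = 0" if "x + y = 0" "x - y = 0" for x y :: complex
  proof -
    have "x = y" using that(2) by simp
    then have "2 * y = 0" using that(1) by simp
    with \<open>x = y\<close> show ?thesis by simp
  qed
  have prod: "g 0 0 * g 1 1 = g 0 1 * g 1 0"
    by (simp add: g_def)
  have "g 0 0 = 0 \<and> g 1 1 = 0 \<and> g 0 1 = 0 \<and> g 1 0 = 0"
  proof (cases a)
    case True
    then have "g 0 0 = 0 \<and> g 1 1 = 0"
      using h[of False False] h[of False True] by (intro sum_diff) (simp_all add: h_def)
    \<comment> \<open>The product relation makes \<open>g 0 1\<close> or \<open>g 1 0\<close> zero,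
      and the other odd combination, with sign \<open>\<not> t\<close>, makes both zero.\<close>
    then show ?thesis
      using prod h[of True "\<not> t"] True by (cases t) (auto simp: h_def)
  next
    case False
    then have "g 0 1 = 0 \<and> g 1 0 = 0"
      using h[of True False] h[of True True] by (intro sum_diff) (simp_all add: h_def)
    then show ?thesis
      using prod h[of False "\<not> t"] False by (cases t) (auto simp: h_def)
  qed
  then show ?thesis unfolding entry by simp
qed

text \<open>Induction with the product operator accumulated along the branch as
  \<open>kron A B\<close>: its row dimensions vary, its column dimensions stay 2. At a leaf a zero
  trace means a zero vector, and \<open>kron_bell_vec_zero\<close> applies entrywise.\<close>

lemma outcome_prob_bell_zero:
  assumes "valid_protocol [dim_row A, dim_row B] P" "dim_col A = 2" "dim_col B = 2"
    and "\<And>b s. (b, s) \<noteq> (a, t) \<Longrightarrow> outcome_prob [dim_row A, dim_row B] P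
      ((kron A B * bell_vec b s) * mat_adjoint (kron A B * bell_vec b s)) x = 0"
  shows "outcome_prob [dim_row A, dim_row B] P
      ((kron A B * bell_vec a t) * mat_adjoint (kron A B * bell_vec a t)) x = 0"
  using assms
proof (induction P arbitrary: A B)
  case (Announce y)
  then show ?case
    using kron_bell_vec_zero[OF Announce.prems(2,3), where a = a and t = t]
    by (cases "x = y") (auto simp: mat_trace_mult_adjoint_eq_0_iff simp del: index_mult_mat(1))
next
  case (Measure k bs)
  let ?ds = "[dim_row A, dim_row B]"
  let ?X = "\<lambda>b s. kron A B * bell_vec b s"
  let ?p = "\<lambda>K P b s. outcome_prob (?ds[k := dim_row K]) P
      (local_op ?ds k K * (?X b s * mat_adjoint (?X b s)) * mat_adjoint (local_op ?ds k K)) x"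
  have K: "dim_col K = ?ds ! k" if "(K, P) \<in> set bs" for K P
    using Measure.prems(1) that by (auto simp: local_measurement_def)
  have k: "k < 2" using Measure.prems(1) by simp
  have dim: "dim_col (local_op ?ds k K) = dim_row (?X b s)" if "(K, P) \<in> set bs" for K P b s
    using local_op_dim(2)[of k ?ds K] K[OF that] k by simp
  \<comment> \<open>A Kraus operator of either party multiplies only that party's factor, so the
    operator remains a product.\<close>
  have "\<exists>A' B'. ?ds[k := dim_row K] = [dim_row A', dim_row B'] \<and> dim_col A' = 2 \<and> dim_col B' = 2 \<and>
      (\<forall>b s. local_op ?ds k K * ?X b s = kron A' B' * bell_vec b s)"
    if KP: "(K, P) \<in> set bs" for K P
  proof -
    have AB: "kron A B \<in> carrier_mat (dim_row A * dim_row B) 4"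
      using Measure.prems(2,3) by (intro carrier_matI) simp_all
    have assoc: "local_op ?ds k K * ?X b s = (local_op ?ds k K * kron A B) * bell_vec b s" for b s
      using dim[OF KP, of b s]
      by (intro assoc_mult_mat[symmetric, OF _ AB]) (auto intro!: carrier_matI)
    consider "k = 0" | "k = 1" using k by linarith
    then show ?thesis
    proof cases
      case 1
      then have "local_op ?ds k K * kron A B = kron (K * A) B"
        using K[OF KP] by (simp add: local_op_def kron_mult)
      then show ?thesis
        using 1 Measure.prems(2,3) unfolding assoc
        by - (rule exI[of _ "K * A"], rule exI[of _ B], simp)
    next
      case 2
      then have "local_op ?ds k K * kron A B = kron A (K * B)"
        using K[OF KP] by (simp add: local_op_def kron_mult)
      then show ?thesis
        using 2 Measure.prems(2,3) unfolding assoc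
        by - (rule exI[of _ A], rule exI[of _ "K * B"], simp)
    qed
  qed
  note reduce = this
  have nonneg: "0 \<le> ?p K P b s" if KP: "(K, P) \<in> set bs" for K P b s
    unfolding conjugate_mult_adjoint[OF dim[OF KP]]
    using Measure.prems(1) KP local_op_dim(1)[of k ?ds K] k
    by (intro outcome_prob_nonneg) auto
  \<comment> \<open>The branch probabilities are nonnegative and sum to zero, so each of them
    vanishes.\<close>
  have zero: "?p K P b s = 0" if KP: "(K, P) \<in> set bs" and "(b, s) \<noteq> (a, t)" for K P b s
  proof -
    have "(\<Sum>(K, P)\<leftarrow>bs. ?p K P b s) = 0" using Measure.prems(4)[OF that(2)] by simp
    moreover have "\<forall>y\<in>set (map (\<lambda>(K, P). ?p K P b s) bs). 0 \<le> y" using nonneg by auto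
    ultimately have "\<forall>y\<in>set (map (\<lambda>(K, P). ?p K P b s) bs). y = 0"
      by (subst (asm) sum_list_nonneg_eq_0_iff) auto
    then show ?thesis using KP by force
  qed
  have "?p K P a t = 0" if KP: "(K, P) \<in> set bs" for K P
  proof -
    obtain A' B' where AB': "?ds[k := dim_row K] = [dim_row A', dim_row B']"
        "dim_col A' = 2" "dim_col B' = 2"
      and X: "\<And>b s. local_op ?ds k K * ?X b s = kron A' B' * bell_vec b s"
      using reduce[OF KP] by blast
    have eq: "?p K P b s = outcome_prob [dim_row A', dim_row B'] P
        ((kron A' B' * bell_vec b s) * mat_adjoint (kron A' B' * bell_vec b s)) x" for b s
      unfolding conjugate_mult_adjoint[OF dim[OF KP]] X AB'(1) ..
    have valid: "valid_protocol [dim_row A', dim_row B'] P"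
      using Measure.prems(1) KP AB'(1) by auto
    show ?thesis
      unfolding eq
    proof (rule Measure.IH[OF KP _ valid AB'(2,3)])
      show "P \<in> Basic_BNFs.snds (K, P)" by (simp add: prod_set_defs)
      fix b s
      assume "(b, s) \<noteq> (a, t)"
      then show "outcome_prob [dim_row A', dim_row B'] P
          ((kron A' B' * bell_vec b s) * mat_adjoint (kron A' B' * bell_vec b s)) x = 0"
        using zero[OF KP] unfolding eq by blast
    qed
  qed
  then have "(\<Sum>(K, P)\<leftarrow>bs. ?p K P a t) = (\<Sum>b\<leftarrow>bs. 0)"
    by (intro arg_cong[where f = sum_list] map_cong) auto
  then show ?case by simp
qed

section \<open>Impossibility of conclusive discrimination for the Bell basis\<close>

definition bell_basis :: "complex mat set" where
  "bell_basis = range (\<lambda>(a, s). bell a s)"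

text \<open>Each identifying outcome has probability zero on the other three Bell states, hence also
  on its own state, so the total success probability is zero.\<close>

lemma bell_basis_not_discriminable: "\<not> conclusively_discriminable [2, 2] bell_basis"
proof
  assume "conclusively_discriminable [2, 2] bell_basis"
  then obtain M where M: "LOCC_povm [2, 2] (insert None (Some ` bell_basis)) M \<and>
      (\<forall>\<sigma>\<in>bell_basis. \<forall>\<tau>\<in>bell_basis. \<sigma> \<noteq> \<tau> \<longrightarrow> mat_trace (M (Some \<sigma>) * \<tau>) = 0) \<and>
      0 < 1 / real (card bell_basis) * (\<Sum>\<sigma>\<in>bell_basis. Re (mat_trace (M (Some \<sigma>) * \<sigma>)))"
    unfolding conclusively_discriminable_def by (rule exE)
  then obtain P where P: "valid_protocol [2, 2] P \<and> (\<forall>R. density_operator (prod_list [2, 2]) R \<longrightarrow>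
      (\<forall>x\<in>insert None (Some ` bell_basis). outcome_prob [2, 2] P R x = mat_trace (M x * R)))"
    unfolding LOCC_povm_def by blast
  have prob: "outcome_prob [2, 2] P (bell b s) (Some (bell a t)) = mat_trace (M (Some (bell a t)) * bell b s)"
    for a b s t
    using P density_bell[of b s] by (auto simp: bell_basis_def)
  have "mat_trace (M (Some (bell a t)) * bell a t) = 0" for a t
  proof -
    \<comment> \<open>At the root of the protocol the accumulated product operator is the
      identity.\<close>
    have one: "(kron (1\<^sub>m 2) (1\<^sub>m 2) * bell_vec b s) * mat_adjoint (kron (1\<^sub>m 2) (1\<^sub>m 2) * bell_vec b s)
        = bell b s" for b s
      by (simp add: kron_one_one bell_def left_mult_one_mat[of _ 4 1] carrier_matI)
    have "outcome_prob [2, 2] P (bell b s) (Some (bell a t)) = 0" if "(b, s) \<noteq> (a, t)" for b s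
    proof -
      have "bell a t \<noteq> bell b s" using bell_inject that by metis
      moreover have "bell a t \<in> bell_basis" "bell b s \<in> bell_basis" by (auto simp: bell_basis_def)
      ultimately show ?thesis using M unfolding prob by blast
    qed
    then have "outcome_prob [2, 2] P (bell a t) (Some (bell a t)) = 0"
      using outcome_prob_bell_zero[of "1\<^sub>m 2" "1\<^sub>m 2" P a t "Some (bell a t)"] P
      unfolding one by simp
    then show ?thesis
      unfolding prob .
  qed
  then have "(\<Sum>\<sigma>\<in>bell_basis. Re (mat_trace (M (Some \<sigma>) * \<sigma>))) = 0"
    by (intro sum.neutral) (auto simp: bell_basis_def)
  with M show False by simp
qed

subsection \<open>Authentication of the Bell basis\<close>

definition coord_proj :: "nat \<Rightarrow> nat set \<Rightarrow> complex mat" where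
  "coord_proj n C = mat n n (\<lambda>(i, j). if i = j \<and> i \<in> C then 1 else 0)"

lemma coord_proj_dim [simp]: "dim_row (coord_proj n C) = n" "dim_col (coord_proj n C) = n"
  by (simp_all add: coord_proj_def)

lemma coord_proj_carrier: "coord_proj n C \<in> carrier_mat n n"
  by (intro carrier_matI) simp_all

text \<open>A self-adjoint projection is its own Gram matrix.\<close>

lemma pos_semidef_coord_proj: "pos_semidef n (coord_proj n C)"
proof -
  have "coord_proj n C * mat_adjoint (coord_proj n C) = coord_proj n C"
  proof (intro eq_matI)
    fix i j
    assume "i < dim_row (coord_proj n C)" "j < dim_col (coord_proj n C)"
    then have ij: "i < n" "j < n" by simp_all
    have "(coord_proj n C * mat_adjoint (coord_proj n C)) $$ (i, j) =
        (\<Sum>k<n. coord_proj n C $$ (i, k) * conjugate (coord_proj n C $$ (j, k)))"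
      using ij by (simp add: mat_mult_index del: index_mult_mat(1))
    also have "\<dots> = (\<Sum>k<n. if k = i then coord_proj n C $$ (i, j) else 0)"
      using ij by (intro sum.cong refl) (auto simp: coord_proj_def)
    also have "\<dots> = coord_proj n C $$ (i, j)" using ij by simp
    finally show "(coord_proj n C * mat_adjoint (coord_proj n C)) $$ (i, j) = coord_proj n C $$ (i, j)" .
  qed simp_all
  then show ?thesis
    using pos_semidef_mult_adjoint[OF coord_proj_carrier] by metis
qed

lemma mat_trace_coord_proj:
  assumes "R \<in> carrier_mat n n" "C \<subseteq> {..<n}"
  shows "mat_trace (coord_proj n C * R) = (\<Sum>i\<in>C. R $$ (i, i))"
proof -
  have "mat_trace (coord_proj n C * R) = (\<Sum>i<n. if i \<in> C then R $$ (i, i) else 0)"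
    unfolding mat_trace_mult_right[OF coord_proj_carrier assms(1)]
  proof (rule sum.cong[OF refl])
    fix i
    assume "i \<in> {..<n}"
    then have "(\<Sum>k<n. coord_proj n C $$ (i, k) * R $$ (k, i)) =
        (\<Sum>k<n. if k = i then (if i \<in> C then R $$ (i, i) else 0) else 0)"
      by (intro sum.cong) (auto simp: coord_proj_def)
    then show "(\<Sum>k<n. coord_proj n C $$ (i, k) * R $$ (k, i)) = (if i \<in> C then R $$ (i, i) else 0)"
      using \<open>i \<in> {..<n}\<close> by simp
  qed
  also have "\<dots> = (\<Sum>i\<in>C. R $$ (i, i))"
    using assms(2) by (simp add: sum.If_cases Int_absorb1)
  finally show ?thesis .
qed

section \<open>Computational-basis measurements of two qubits\<close>

text \<open>As a Kraus operator with one-dimensional output, it discards the measured qubit and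
  leaves dimension 1 at that party.\<close>

definition bra :: "nat \<Rightarrow> complex mat" where
  "bra b = mat 1 2 (\<lambda>(_, j). if j = b then 1 else 0)"

lemma bra_dim [simp]: "dim_row (bra b) = 1" "dim_col (bra b) = 2"
  by (simp_all add: bra_def)

lemma lessThan_2: "{..<2 :: nat} = {0, 1}"
  by auto

lemma local_measurement_bra:
  assumes "c < 2"
  shows "local_measurement 2 [bra c, bra (1 - c)]"
proof -
  have "c = 0 \<or> c = 1" using assms by auto
  then have "mat_sum 2 (\<lambda>i. mat_adjoint ([bra c, bra (1 - c)] ! i) * [bra c, bra (1 - c)] ! i) {..<2} = 1\<^sub>m 2"
    by (intro eq_matI)
      (auto simp: mat_mult_index bra_def lessThan_2 less_2_cases_iff simp del: index_mult_mat(1))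
  then show ?thesis by (simp add: local_measurement_def numeral_2_eq_2)
qed

text \<open>In the lexicographic basis, the value \<open>b\<close> of the first qubit occupies the
  indices \<open>2 * b\<close> and \<open>2 * b + 1\<close>; the outcome therefore cuts out a
  diagonal block.\<close>

lemma bra_first:
  assumes R: "R \<in> carrier_mat 4 4" and b: "b < 2"
  shows "local_op [2, 2] 0 (bra b) * R * mat_adjoint (local_op [2, 2] 0 (bra b)) =
    mat 2 2 (\<lambda>(i, j). R $$ (2 * b + i, 2 * b + j))"
proof -
  have dims: "dim_row R = 4" "dim_col R = 4" using R by auto
  define L where "L = local_op [2, 2] 0 (bra b)"
  have L_kron: "L = kron (bra b) (1\<^sub>m 2)" by (simp add: L_def local_op_def)
  then have L_dims: "dim_row L = 2" "dim_col L = 4" by simp_all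
  have L: "L $$ (i, j) = (if j = 2 * b + i then 1 else 0)" if "i < 2" "j < 4" for i j
    using that by (simp add: L_kron bra_def) auto
  have sel: "(\<Sum>k<4. (if k = p then 1 else 0) * f k) = f p" if "p < 4" for p and f :: "nat \<Rightarrow> complex"
  proof -
    have "(\<Sum>k<4. (if k = p then 1 else 0) * f k) = (\<Sum>k<4. if k = p then f p else 0)"
      by (intro sum.cong) auto
    then show ?thesis using that by simp
  qed
  have LR: "(L * R) $$ (i, k) = R $$ (2 * b + i, k)" if "i < 2" "k < 4" for i k
    using that b sel[of "2 * b + i" "\<lambda>l. R $$ (l, k)"]
    by (simp add: mat_mult_index L L_dims dims del: index_mult_mat(1))
  show ?thesis
    unfolding L_def[symmetric]
  proof (intro eq_matI)
    fix i j
    assume "i < dim_row (mat 2 2 (\<lambda>(i, j). R $$ (2 * b + i, 2 * b + j)))"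
      "j < dim_col (mat 2 2 (\<lambda>(i, j). R $$ (2 * b + i, 2 * b + j)))"
    then have ij: "i < 2" "j < 2" by simp_all
    then have "(L * R * mat_adjoint L) $$ (i, j) =
        (\<Sum>k<4. (if k = 2 * b + j then 1 else 0) * R $$ (2 * b + i, k))"
      using mat_mult_index[of i "L * R" j "mat_adjoint L"]
      by (simp add: LR L L_dims dims ij mult.commute if_distrib[of cnj] cong: if_cong del: index_mult_mat(1))
    also have "\<dots> = R $$ (2 * b + i, 2 * b + j)" using ij b by (intro sel) simp
    finally show "(L * R * mat_adjoint L) $$ (i, j) =
        mat 2 2 (\<lambda>(i, j). R $$ (2 * b + i, 2 * b + j)) $$ (i, j)" using ij by simp
  qed (simp_all add: L_dims)
qed

lemma bra_second:
  assumes R: "R \<in> carrier_mat 2 2" and c: "c < 2"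
  shows "mat_trace (local_op [1, 2] 1 (bra c) * R * mat_adjoint (local_op [1, 2] 1 (bra c))) = R $$ (c, c)"
proof -
  have dims: "dim_row R = 2" "dim_col R = 2" using R by auto
  have "c = 0 \<or> c = 1" using c by auto
  moreover have "local_op [1, 2] 1 (bra c) = bra c" by (simp add: local_op_def)
  ultimately show ?thesis
    by (auto simp: mat_trace_def mat_mult_index dims bra_def lessThan_2 simp del: index_mult_mat(1))
qed

lemma bell_basis_answerable: "conclusively_answerable [2, 2] bell_basis (bell a s)"
proof -
  \<comment> \<open>The product vector with first bit 0 and second bit \<open>c\<close> has basis
    index \<open>c\<close> and the parity opposite to \<open>a\<close>, so it is orthogonal to
    \<open>bell a s\<close>.\<close>
  define c where "c = (if a then 0 else 1 :: nat)"
  have c: "c < 2" "c = 0 \<or> c = 1" by (auto simp: c_def)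
  \<comment> \<open>Only the outcomes 0, then \<open>c\<close>, yield \<open>No\<close>; all other
    branches are given up as inconclusive.\<close>
  define P where "P = Measure 0
    [(bra 0, Measure 1 [(bra c, Announce No), (bra (1 - c), Announce Inconclusive)]),
     (bra 1, Announce Inconclusive)]"
  \<comment> \<open>\<open>Yes\<close> is never announced, so its effect is the projection onto the
    zero space.\<close>
  define M where "M = (\<lambda>x. coord_proj 4 (case x of Yes \<Rightarrow> {} | No \<Rightarrow> {c} | Inconclusive \<Rightarrow> {..<4} - {c}))"
  have "local_measurement 2 [bra 0, bra 1]" using local_measurement_bra[of 0] by simp
  then have valid: "valid_protocol [2, 2] P"
    using local_measurement_bra[OF c(1)] by (simp add: P_def)
  have prob: "outcome_prob [2, 2] P R x = mat_trace (M x * R)" if "density_operator 4 R" for R x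
  proof -
    have R: "R \<in> carrier_mat 4 4" using that by (simp add: density_operator_def pos_semidef_def)
    let ?Q = "\<lambda>b. mat 2 2 (\<lambda>(i, j). R $$ (2 * b + i, 2 * b + j))"
    have Q: "?Q b \<in> carrier_mat 2 2" for b by simp
    have "outcome_prob [2, 2] P R x =
        (if x = No then R $$ (c, c) else 0) +
        (if x = Inconclusive then R $$ (1 - c, 1 - c) + R $$ (2, 2) + R $$ (3, 3) else 0)"
    proof -
      have "outcome_prob [2, 2] P R x =
        (if x = No then ?Q 0 $$ (c, c) else 0) + (if x = Inconclusive then ?Q 0 $$ (1 - c, 1 - c) else 0) +
        (if x = Inconclusive then mat_trace (?Q 1) else 0)"
        using bra_first[OF R, of 0] bra_first[OF R, of 1] bra_second[OF Q[of 0] c(1)]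
          bra_second[OF Q[of 0], of "1 - c"]
        by (simp add: P_def)
      then show ?thesis using c by (auto simp: mat_trace_def lessThan_2 numeral_2_eq_2 numeral_3_eq_3)
    qed
    also have "\<dots> = mat_trace (M x * R)"
      using c(2) by (cases x) (auto simp: M_def mat_trace_coord_proj[OF R] lessThan_4 insert_Diff_if)
    finally show ?thesis .
  qed
  have "mat_sum 4 M {Yes, No, Inconclusive} = 1\<^sub>m 4"
    using c by (intro eq_matI) (auto simp: M_def coord_proj_def)
  then have LOCC: "LOCC_povm [2, 2] {Yes, No, Inconclusive} M"
    unfolding LOCC_povm_def is_povm_def
    using valid prob pos_semidef_coord_proj[of 4]
    by (intro conjI ballI exI[of _ P] allI impI) (simp_all add: M_def)
  have No: "mat_trace (M No * bell b t) = (if b = a then 0 else 1 / 2)" for b t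
    using c by (simp add: M_def mat_trace_coord_proj[OF bell_carrier] bell_index) (auto simp: c_def)
  have Yes: "mat_trace (M Yes * bell b t) = 0" for b t
    by (simp add: M_def mat_trace_coord_proj[OF bell_carrier])
  have total: "mat_trace ((M Yes + M No) * bell b t) = (if b = a then 0 else 1 / 2)" for b t
    using mat_trace_add_mult[of "M Yes" 4 "M No" "bell b t"] Yes No
    by (simp add: M_def coord_proj_carrier bell_carrier)
  have fin: "finite bell_basis" by (simp add: bell_basis_def)
  \<comment> \<open>The witness \<open>bell (\<not> a) s\<close> has the other parity and triggers
    \<open>No\<close> with probability 1/2; no summand is negative.\<close>
  have "0 < (\<Sum>\<sigma>\<in>bell_basis. Re (mat_trace ((M Yes + M No) * \<sigma>)))"
  proof (rule sum_pos2[OF fin])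
    show "bell (\<not> a) s \<in> bell_basis" by (auto simp: bell_basis_def)
  qed (auto simp: total bell_basis_def)
  moreover have "0 < card bell_basis" using fin by (auto simp: card_gt_0_iff bell_basis_def)
  ultimately have pos: "0 < 1 / real (card bell_basis) *
      (\<Sum>\<sigma>\<in>bell_basis. Re (mat_trace ((M Yes + M No) * \<sigma>)))"
    by simp
  show ?thesis
    unfolding conclusively_answerable_def
    using LOCC Yes No pos by (intro exI[of _ M] conjI ballI impI) (auto simp: bell_basis_def)
qed

theorem theorem4:
  shows "(\<forall>(ds :: nat list) (S :: complex mat set).
            multipartite_system ds \<and> finite S \<and> S \<noteq> {} \<and> orthogonal_states ds S \<and>
            conclusively_discriminable ds S \<longrightarrow> conclusive_LRA ds S)
       \<and> (\<exists>(ds :: nat list) (S :: complex mat set).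
            multipartite_system ds \<and> finite S \<and> S \<noteq> {} \<and> orthogonal_states ds S \<and>
            conclusive_LRA ds S \<and> \<not> conclusively_discriminable ds S)"
proof
  show "\<forall>(ds :: nat list) (S :: complex mat set).
      multipartite_system ds \<and> finite S \<and> S \<noteq> {} \<and> orthogonal_states ds S \<and>
      conclusively_discriminable ds S \<longrightarrow> conclusive_LRA ds S"
    unfolding conclusive_LRA_def
    by (intro allI impI ballI conclusively_answerable_if_discriminable) simp_all
  have "multipartite_system [2, 2]" by (simp add: multipartite_system_def)
  moreover have "finite bell_basis" "bell_basis \<noteq> {}" by (simp_all add: bell_basis_def)
  moreover have "orthogonal_states [2, 2] bell_basis"
    by (auto simp: orthogonal_states_def bell_basis_def density_bell intro!: bell_orthogonal)
  moreover have "conclusive_LRA [2, 2] bell_basis"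
    using bell_basis_answerable by (auto simp: conclusive_LRA_def bell_basis_def)
  ultimately show "\<exists>(ds :: nat list) (S :: complex mat set).
      multipartite_system ds \<and> finite S \<and> S \<noteq> {} \<and> orthogonal_states ds S \<and>
      conclusive_LRA ds S \<and> \<not> conclusively_discriminable ds S"
    using bell_basis_not_discriminable
    by (intro exI[of _ "[2, 2]"] exI[of _ bell_basis] conjI)
qed

end
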